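(* For all integers $m\ge 2$ and $n\ge 1$, $$\operatorname{Vol}(\mathcal{Q}_{m,n}\cap \mathcal{D}_{m,n})=\sum_{t=0}^{m}\binom{m}{t}\Bigl(-\frac1n\Bigr)^{t}\,t!\,[z^{t}]\,g_m(z)^n ,\qquad\text{where } g_m(z):=\sum_{t\ge 0}\frac{z^t}{t!\,(m-1+t)!}.$$ In particular, for all $n\ge1$, $$\operatorname{Vol}(\mathcal{Q}_{2,n}\cap \mathcal{D}_{2,n})=\frac{3n-1}{12n},\qquad \operatorname{Vol}(\mathcal{Q}_{3,n}\cap \mathcal{D}_{3,n})=\frac{80n^2-15n-2}{270\cdot 2^n\,n^2}.$$ Moreover, for each $m\ge2$, the quantity $((m-1)!)^{n}\operatorname{Vol}(\mathcal{Q}_{m,n}\cap \mathcal{D}_{m,n})$, as a function of $n\ge1$, is a polynomial in $1/n$ of degree at most $m$, with constant term $(1-1/m)^m$.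
   Context: Let $m\ge2$, $n\ge1$ be integers, $M=\{1,\dots,m\}$, $N=\{1,\dots,n\}$. The set $\mathcal{Q}_{m,n}$ (weak relaxation) consists of all $(x,y)\in\mathbb{R}^{m\times n}\times\mathbb{R}^m$ with $\sum_{j\in N}x_{ij}\le n y_i$ for all $i\in M$, $0\le x_{ij}\le 1$ for all $(i,j)\in M\times N$, and $y_i\le1$ for all $i\in M$. The demand constraints define $\mathcal{D}_{m,n}=\{(x,y)\in\mathbb{R}^{m\times n}\times\mathbb{R}^m:\ \sum_{i\in M}x_{ij}=1\ \ \forall j\in N\}$, an affine subspace of dimension $d=(m-1)n+m$. Let $\pi$ be the coordinate projection that deletes the variables $x_{mj}$, $j\in N$; it restricts to an affine bijection $\mathcal{D}_{m,n}\to\mathbb{R}^d$. For $K\subset\mathcal{D}_{m,n}$, $\operatorname{Vol}(K)$ denotes the $d$-dimensional Lebesgue measure of $\pi(K)$. For a power series $F(z)=\sum_{t\ge0}c_tz^t$, $[z^t]F(z):=c_t$. *)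

theory Defs
  imports "HOL-Analysis.Analysis" "HOL-Computational_Algebra.Formal_Power_Series"
begin

text \<open>
  The dimensions depend on natural numbers over which the theorem quantifies, so a point
  \<open>(x, y)\<close> of $\mathbb{R}^{m \times n} \times \mathbb{R}^m$ is a pair of extensional functions
  on the index sets \<open>{1..m} \<times> {1..n}\<close> and \<open>{1..m}\<close>.
\<close>

type_synonym point = "(nat \<times> nat \<Rightarrow> real) \<times> (nat \<Rightarrow> real)"

definition ambient :: "nat \<Rightarrow> nat \<Rightarrow> point set" where
  "ambient m n = (({1..m} \<times> {1..n}) \<rightarrow>\<^sub>E UNIV) \<times> ({1..m} \<rightarrow>\<^sub>E UNIV)"

definition weak_relaxation :: "nat \<Rightarrow> nat \<Rightarrow> point set" where
  "weak_relaxation m n =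
     {(x, y) \<in> ambient m n.
        (\<forall>i\<in>{1..m}. (\<Sum>j\<in>{1..n}. x (i, j)) \<le> real n * y i) \<and>
        (\<forall>i\<in>{1..m}. \<forall>j\<in>{1..n}. 0 \<le> x (i, j) \<and> x (i, j) \<le> 1) \<and>
        (\<forall>i\<in>{1..m}. y i \<le> 1)}"

definition demand_space :: "nat \<Rightarrow> nat \<Rightarrow> point set" where
  "demand_space m n =
     {(x, y) \<in> ambient m n. \<forall>j\<in>{1..n}. (\<Sum>i\<in>{1..m}. x (i, j)) = 1}"

definition demand_proj :: "nat \<Rightarrow> nat \<Rightarrow> point \<Rightarrow> point" where
  "demand_proj m n = (\<lambda>(x, y). (restrict x ({1..m - 1} \<times> {1..n}), y))"

text \<open>
  Lebesgue measure of dimension \<open>(m - 1) * n + m\<close>: the completion of the product of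
  one-dimensional Borel-Lebesgue measures over all coordinates that \<open>demand_proj m n\<close> keeps.
\<close>

definition proj_lebesgue :: "nat \<Rightarrow> nat \<Rightarrow> point measure" where
  "proj_lebesgue m n =
     completion ((\<Pi>\<^sub>M p\<in>{1..m - 1} \<times> {1..n}. lborel) \<Otimes>\<^sub>M (\<Pi>\<^sub>M i\<in>{1..m}. lborel))"

definition Vol :: "nat \<Rightarrow> nat \<Rightarrow> point set \<Rightarrow> real" where
  "Vol m n K = measure (proj_lebesgue m n) (demand_proj m n ` K)"

definition g_series :: "nat \<Rightarrow> real fps" where
  "g_series m = Abs_fps (\<lambda>t. 1 / (fact t * fact (m - 1 + t)))"

end

theory Submission
  imports Defs
begin

text \<open>
  Put $m = k + 1$ and $S_i = \sum_j x_{ij}$. For fixed $x$ the admissible $y$ form the box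
  $\prod_i [S_i/n, 1]$, so the volume is the integral of $\prod_i (1 - S_i/n)$ over $n$ independent
  columns, each ranging over a $k$-dimensional simplex. Expanding the product over subsets $T$ of the
  rows leaves the integrals of $\prod_{i \in T} S_i$. Adding one column at a time and splitting $T$
  into the rows served by the new column and the others, Dirichlet's integral
  $1/(k + |B|)!$ of $\prod_{i \in B} x_{ij}$ makes these integrals satisfy the recurrence of
  $|T|!\,[z^{|T|}]\, g_m(z)^n$. Polynomiality in $1/n$ comes from the binomial expansion of
  $((m-1)!\,g_m)^n = (1 + a)^n$ with $a(0) = 0$.
\<close>

subsection \<open>Dirichlet integrals\<close>

text \<open>Euler's Beta integral, rescaled to \<open>[0, s]\<close>. Integration by parts trades
  one power of \<open>t\<close> for one power of \<open>s - t\<close>, so the induction on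
  \<open>a\<close> must leave \<open>c\<close> arbitrary.\<close>

lemma has_integral_power_mult_power_diff:
  fixes s :: real
  assumes "0 \<le> s"
  shows "((\<lambda>t. t ^ a * (s - t) ^ c) has_integral
           s ^ (a + c + 1) * (fact a * fact c / fact (a + c + 1))) {0..s}"
proof (induction a arbitrary: c)
  case 0
  have "((\<lambda>t. (s - t) ^ c) has_integral
      (- ((s - s) ^ (c + 1) / real (c + 1)) - (- ((s - 0) ^ (c + 1) / real (c + 1))))) {0..s}"
    by (rule fundamental_theorem_of_calculus[OF assms])
       (auto intro!: derivative_eq_intros
             simp flip: has_real_derivative_iff_has_vector_derivative simp del: of_nat_Suc power_Suc)
  moreover have "s ^ (c + 1) / real (c + 1) = s ^ (c + 1) * (fact c / fact (c + 1))"
    by (simp del: of_nat_Suc)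
  ultimately show ?case
    by simp
next
  case (Suc a)
  let ?I = "s ^ (a + (c + 1) + 1) * (fact a * fact (c + 1) / fact (a + (c + 1) + 1))"
  \<comment> \<open>The integrand is the derivative of
    \<open>t ^ (a + 1) * (s - t) ^ (c + 1)\<close>, which vanishes at both ends of the
    interval.\<close>
  have parts: "((\<lambda>t. real (a + 1) * (t ^ a * (s - t) ^ (c + 1)) - real (c + 1) * (t ^ (a + 1) * (s - t) ^ c))
      has_integral (s ^ (a + 1) * (s - s) ^ (c + 1) - 0 ^ (a + 1) * (s - 0) ^ (c + 1))) {0..s}"
    by (rule fundamental_theorem_of_calculus[OF assms])
       (auto intro!: derivative_eq_intros
             simp flip: has_real_derivative_iff_has_vector_derivative
             simp: algebra_simps simp del: power_Suc of_nat_Suc)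
  have "((\<lambda>t. real (c + 1) * (t ^ (a + 1) * (s - t) ^ c)) has_integral (real (a + 1) * ?I)) {0..s}"
    using has_integral_diff[OF has_integral_mult_right[OF Suc.IH[of "c + 1"], of "real (a + 1)"] parts]
    by simp
  from has_integral_mult_right[OF this, of "1 / real (c + 1)"]
  have "((\<lambda>t. t ^ (a + 1) * (s - t) ^ c) has_integral (1 / real (c + 1) * (real (a + 1) * ?I))) {0..s}"
    by (simp del: of_nat_Suc of_nat_add)
  moreover have "1 / real (c + 1) * (real (a + 1) * ?I) =
      s ^ (Suc a + c + 1) * (fact (Suc a) * fact c / fact (Suc a + c + 1))"
    by (simp add: divide_simps del: of_nat_Suc)
  ultimately show ?case
    by (simp add: mult_ac)
qed

text \<open>Putting the range of integration into the integrand as \<open>of_bool\<close> gives the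
  form in which the integral arises when one coordinate of a simplex is split off.\<close>

lemma nn_integral_power_mult_power_diff:
  fixes s :: real
  assumes "0 \<le> s"
  shows "(\<integral>\<^sup>+ t. ennreal (of_bool (0 \<le> t \<and> t \<le> s) * (t ^ a * (s - t) ^ c)) \<partial>lborel) =
         ennreal (s ^ (a + c + 1) * (fact a * fact c / fact (a + c + 1)))"
proof (rule nn_integral_has_integral_lborel)
  have "((\<lambda>t. if t \<in> {0..s} then t ^ a * (s - t) ^ c else 0) has_integral
      s ^ (a + c + 1) * (fact a * fact c / fact (a + c + 1))) UNIV"
    using has_integral_power_mult_power_diff[OF assms] by (simp only: has_integral_restrict_UNIV)
  also have "(\<lambda>t. if t \<in> {0..s} then t ^ a * (s - t) ^ c else 0) =
      (\<lambda>t. of_bool (0 \<le> t \<and> t \<le> s) * (t ^ a * (s - t) ^ c))"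
    by auto
  finally show "((\<lambda>t. of_bool (0 \<le> t \<and> t \<le> s) * (t ^ a * (s - t) ^ c)) has_integral
      s ^ (a + c + 1) * (fact a * fact c / fact (a + c + 1))) UNIV" .
qed auto

interpretation lborel_product: product_sigma_finite "\<lambda>_::'i. lborel :: real measure"
  by standard

lemma measurable_dirichlet:
  fixes s :: real
  assumes "finite K"
  shows "(\<lambda>u. of_bool ((\<forall>i\<in>K. 0 \<le> u i) \<and> sum u K \<le> s) *
           ((s - sum u K) ^ b * (\<Prod>i\<in>K. u i ^ \<alpha> i)))
         \<in> borel_measurable (\<Pi>\<^sub>M i\<in>K. (lborel :: real measure))"
  using assms by measurable

text \<open>Fixing one coordinate \<open>t\<close> leaves an integral of the same kind over a
  simplex of size \<open>s - t\<close>. By induction it is a constant times a power of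
  \<open>s - t\<close>, and the Beta integral over \<open>t\<close> finishes. Hence \<open>s\<close>
  is generalized, and \<open>of_bool (0 \<le> s)\<close> records that the simplex is empty for
  negative size.\<close>

lemma dirichlet_integral:
  fixes s :: real and \<alpha> :: "'i \<Rightarrow> nat"
  assumes "finite K"
  shows "(\<integral>\<^sup>+ u. ennreal (of_bool ((\<forall>i\<in>K. 0 \<le> u i) \<and> sum u K \<le> s) *
            ((s - sum u K) ^ b * (\<Prod>i\<in>K. u i ^ \<alpha> i))) \<partial>(\<Pi>\<^sub>M i\<in>K. lborel)) =
         ennreal (of_bool (0 \<le> s) * s ^ (card K + b + sum \<alpha> K) *
            (fact b * (\<Prod>i\<in>K. fact (\<alpha> i)) / fact (card K + b + sum \<alpha> K)))"
  using assms
proof (induction K arbitrary: s rule: finite_induct)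
  case empty
  then show ?case by (subst lborel_product.nn_integral_empty) auto
next
  case (insert i K)
  define c where "c = card K + b + sum \<alpha> K"
  define C :: real where "C = fact b * (\<Prod>i\<in>K. fact (\<alpha> i)) / fact c"
  have C: "0 \<le> C" unfolding C_def by (intro divide_nonneg_nonneg mult_nonneg_nonneg prod_nonneg) auto
  have [simp]: "(u(i := t)) l = u l" if "l \<in> K" for u :: "'i \<Rightarrow> real" and t l
    using insert.hyps that by auto
  have upd: "sum (u(i := t)) (insert i K) = t + sum u K"
      "(\<Prod>l\<in>insert i K. (u(i := t)) l ^ \<alpha> l) = t ^ \<alpha> i * (\<Prod>l\<in>K. u l ^ \<alpha> l)"
      "(\<forall>l\<in>insert i K. 0 \<le> (u(i := t)) l) \<longleftrightarrow> 0 \<le> t \<and> (\<forall>l\<in>K. 0 \<le> u l)"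
    for u :: "'i \<Rightarrow> real" and t
    using insert.hyps by (simp_all del: fun_upd_apply add: fun_upd_same)
  let ?F = "\<lambda>K s u. of_bool ((\<forall>l\<in>K. 0 \<le> u l) \<and> sum u K \<le> s) *
            ((s - sum u K) ^ b * (\<Prod>l\<in>K. u l ^ \<alpha> l))"
  have "(\<integral>\<^sup>+ u. ennreal (?F (insert i K) s u) \<partial>(\<Pi>\<^sub>M i\<in>insert i K. lborel)) =
        (\<integral>\<^sup>+ t. \<integral>\<^sup>+ u. ennreal (?F (insert i K) s (u(i := t))) \<partial>(\<Pi>\<^sub>M i\<in>K. lborel) \<partial>lborel)"
    using insert.hyps measurable_dirichlet[of "insert i K" s b \<alpha>]
    by (intro lborel_product.product_nn_integral_insert_rev) auto
  also have "\<dots> = (\<integral>\<^sup>+ t. \<integral>\<^sup>+ u. ennreal (of_bool (0 \<le> t) * t ^ \<alpha> i) *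
            ennreal (?F K (s - t) u) \<partial>(\<Pi>\<^sub>M i\<in>K. lborel) \<partial>lborel)"
  proof (intro nn_integral_cong)
    fix t u
    have "?F (insert i K) s (u(i := t)) = (of_bool (0 \<le> t) * t ^ \<alpha> i) * ?F K (s - t) u"
      unfolding upd by (auto simp: algebra_simps)
    then show "ennreal (?F (insert i K) s (u(i := t))) =
        ennreal (of_bool (0 \<le> t) * t ^ \<alpha> i) * ennreal (?F K (s - t) u)"
      by (simp add: ennreal_mult')
  qed
  also have "\<dots> = (\<integral>\<^sup>+ t. ennreal (of_bool (0 \<le> t) * t ^ \<alpha> i) *
      ennreal (of_bool (0 \<le> s - t) * (s - t) ^ c * C) \<partial>lborel)"
    using insert.hyps by (subst nn_integral_cmult) (auto simp: insert.IH c_def C_def measurable_dirichlet)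
  \<comment> \<open>The sign conditions on \<open>t\<close> and on the remaining size
    \<open>s - t\<close> combine to the range of the Beta integral.\<close>
  also have "\<dots> = (\<integral>\<^sup>+ t. ennreal C *
      ennreal (of_bool (0 \<le> t \<and> t \<le> s) * (t ^ \<alpha> i * (s - t) ^ c)) \<partial>lborel)"
    using C by (intro nn_integral_cong) (auto simp: mult_ac simp flip: ennreal_mult)
  also have "\<dots> = ennreal C * (\<integral>\<^sup>+ t.
      ennreal (of_bool (0 \<le> t \<and> t \<le> s) * (t ^ \<alpha> i * (s - t) ^ c)) \<partial>lborel)"
    by (rule nn_integral_cmult) simp
  also have "\<dots> = ennreal (of_bool (0 \<le> s) * s ^ (card (insert i K) + b + sum \<alpha> (insert i K)) *
            (fact b * (\<Prod>i\<in>insert i K. fact (\<alpha> i)) / fact (card (insert i K) + b + sum \<alpha> (insert i K))))"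
  proof (cases "0 \<le> s")
    case True
    let ?d = "\<alpha> i + c + 1"
    have d: "card (insert i K) + b + sum \<alpha> (insert i K) = ?d"
      using insert.hyps by (simp add: c_def)
    have "ennreal C * ennreal (s ^ ?d * (fact (\<alpha> i) * fact c / fact ?d)) =
        ennreal (C * (s ^ ?d * (fact (\<alpha> i) * fact c / fact ?d)))"
      using C by (simp only: ennreal_mult')
    also have "C * (s ^ ?d * (fact (\<alpha> i) * fact c / fact ?d)) =
        s ^ ?d * (fact b * (\<Prod>i\<in>insert i K. fact (\<alpha> i)) / fact ?d)"
      using insert.hyps by (simp add: C_def del: fact_Suc)
    finally show ?thesis
      unfolding nn_integral_power_mult_power_diff[OF True] d using True by simp
  next
    case False
    then have "(\<lambda>t. ennreal (of_bool (0 \<le> t \<and> t \<le> s) * (t ^ \<alpha> i * (s - t) ^ c))) = (\<lambda>t. 0)"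
      by (auto simp: fun_eq_iff)
    then show ?thesis using False by simp
  qed
  finally show ?case .
qed

subsection \<open>Integration over columns\<close>

text \<open>
  Row \<open>Suc k\<close> is the one eliminated by the projection: \<open>share k i j x\<close> is the entry $x_{ij}$ of the
  full matrix, and \<open>feasible k j x\<close> says that column \<open>j\<close> of that matrix is nonnegative.
\<close>

definition share :: "nat \<Rightarrow> nat \<Rightarrow> nat \<Rightarrow> (nat \<times> nat \<Rightarrow> real) \<Rightarrow> real" where
  "share k i j x = (if i = Suc k then 1 - (\<Sum>l\<in>{1..k}. x (l, j)) else x (i, j))"

definition feasible :: "nat \<Rightarrow> nat \<Rightarrow> (nat \<times> nat \<Rightarrow> real) \<Rightarrow> bool" where
  "feasible k j x \<longleftrightarrow> (\<forall>i\<in>{1..k}. 0 \<le> x (i, j)) \<and> (\<Sum>i\<in>{1..k}. x (i, j)) \<le> 1"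

lemma share_nonneg: "feasible k j x \<Longrightarrow> i \<in> {1..Suc k} \<Longrightarrow> 0 \<le> share k i j x"
  by (auto simp: feasible_def share_def)

lemma share_cong:
  "(\<And>l. l \<in> {1..k} \<Longrightarrow> x (l, j) = y (l, j)) \<Longrightarrow> i \<in> {1..Suc k} \<Longrightarrow> share k i j x = share k i j y"
  by (auto simp: share_def intro!: sum.cong)

text \<open>Like \<open>share_cong\<close>, this expresses that only column \<open>j\<close>
  matters, so that a new column separates from the old ones under \<open>merge\<close>.\<close>

lemma feasible_cong:
  "(\<And>l. l \<in> {1..k} \<Longrightarrow> x (l, j) = y (l, j)) \<Longrightarrow> feasible k j x \<longleftrightarrow> feasible k j y"
  using sum.cong[OF refl, of "{1..k}" "\<lambda>l. x (l, j)" "\<lambda>l. y (l, j)"] by (simp add: feasible_def)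

lemma measurable_share [measurable]:
  assumes "i \<in> {1..Suc k}" "j \<in> J"
  shows "share k i j \<in> borel_measurable (\<Pi>\<^sub>M p\<in>{1..k} \<times> J. (lborel :: real measure))"
proof (cases "i = Suc k")
  case True
  then show ?thesis using assms unfolding share_def[abs_def] by simp
next
  case False
  then have "(i, j) \<in> {1..k} \<times> J" using assms by auto
  then have "(\<lambda>x. x (i, j)) \<in> borel_measurable (\<Pi>\<^sub>M p\<in>{1..k} \<times> J. (lborel :: real measure))"
    by measurable
  then show ?thesis unfolding share_def[abs_def] using False by simp
qed

lemma measurable_feasible [measurable]:
  assumes "j \<in> J"
  shows "Measurable.pred (\<Pi>\<^sub>M p\<in>{1..k} \<times> J. (lborel :: real measure)) (feasible k j)"
  using assms unfolding feasible_def[abs_def] by simp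

text \<open>Brings the product into the monomial form of Dirichlet's integral: all exponents are 0
  or 1, and the eliminated row plays the part of the slack.\<close>

lemma prod_share:
  assumes T: "T \<subseteq> {1..Suc k}"
  shows "(\<Prod>i\<in>T. share k i j x) =
    (1 - (\<Sum>l\<in>{1..k}. x (l, j))) ^ of_bool (Suc k \<in> T) * (\<Prod>l\<in>{1..k}. x (l, j) ^ of_bool (l \<in> T))"
proof -
  have "(\<Prod>i\<in>T. share k i j x) = (\<Prod>i\<in>{1..Suc k}. share k i j x ^ of_bool (i \<in> T))"
    by (rule prod.mono_neutral_cong_left) (use T in auto)
  also have "\<dots> = (\<Prod>i\<in>{1..k}. share k i j x ^ of_bool (i \<in> T)) * share k (Suc k) j x ^ of_bool (Suc k \<in> T)"
    by (simp add: prod.nat_ivl_Suc')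
  also have "(\<Prod>i\<in>{1..k}. share k i j x ^ of_bool (i \<in> T)) = (\<Prod>l\<in>{1..k}. x (l, j) ^ of_bool (l \<in> T))"
    by (intro prod.cong) (auto simp: share_def)
  finally show ?thesis by (simp add: share_def)
qed

text \<open>Dirichlet's integral with \<open>s = 1\<close>. Exponents 0 and 1 have factorial 1, so
  the numerator is 1; the denominator is the factorial of the dimension \<open>k\<close> plus the
  degree \<open>card T\<close>.\<close>

lemma nn_integral_prod_share:
  assumes T: "T \<subseteq> {1..Suc k}"
  shows "(\<integral>\<^sup>+ x. ennreal (of_bool (feasible k j x) * (\<Prod>i\<in>T. share k i j x))
            \<partial>(\<Pi>\<^sub>M p\<in>{1..k} \<times> {j}. lborel)) = ennreal (1 / fact (k + card T))"
proof -
  let ?K = "{1..k} \<times> {j}" and ?\<alpha> = "\<lambda>p. of_bool (fst p \<in> T) :: nat"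
  have K: "?K = (\<lambda>i. (i, j)) ` {1..k}" by auto
  have inj: "inj_on (\<lambda>i. (i, j)) {1..k}" by (auto intro: inj_onI)
  have sumK: "sum h ?K = (\<Sum>i\<in>{1..k}. h (i, j))" for h :: "nat \<times> nat \<Rightarrow> 'a :: comm_monoid_add"
    unfolding K by (subst sum.reindex[OF inj]) simp
  have prodK: "prod h ?K = (\<Prod>i\<in>{1..k}. h (i, j))" for h :: "nat \<times> nat \<Rightarrow> 'a :: comm_monoid_mult"
    unfolding K by (subst prod.reindex[OF inj]) simp
  have fin: "finite T" using T finite_subset by blast
  have "(\<Sum>i\<in>{1..k}. of_bool (i \<in> T) :: nat) = card (T \<inter> {1..k})"
    by (simp add: Int_commute flip: sum.inter_filter add: Int_def)
  \<comment> \<open>Row \<open>Suc k\<close> enters the degree through the exponent of the slack,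
    the other rows through \<open>?\<alpha>\<close>.\<close>
  moreover have "card T = card (T \<inter> {1..k}) + of_bool (Suc k \<in> T)"
  proof -
    have "T = (T \<inter> {1..k}) \<union> (T \<inter> {Suc k})" using T by (auto simp: le_Suc_eq)
    then have "card T = card (T \<inter> {1..k}) + card (T \<inter> {Suc k})"
      using fin by (metis card_Un_disjoint finite_Int Int_left_commute Int_assoc Int_empty_right
          Int_insert_right atLeastAtMost_iff Suc_n_not_le_n)
    also have "card (T \<inter> {Suc k}) = of_bool (Suc k \<in> T)" by auto
    finally show ?thesis .
  qed
  ultimately have card: "card ?K + of_bool (Suc k \<in> T) + sum ?\<alpha> ?K = k + card T"
    unfolding sumK by (simp add: card_cartesian_product)
  have factorials: "(\<Prod>p\<in>?K. fact (?\<alpha> p)) = (1 :: real)"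
    by (intro prod.neutral) auto
  have "(\<integral>\<^sup>+ x. ennreal (of_bool (feasible k j x) * (\<Prod>i\<in>T. share k i j x))
            \<partial>(\<Pi>\<^sub>M p\<in>?K. lborel)) =
        (\<integral>\<^sup>+ u. ennreal (of_bool ((\<forall>p\<in>?K. 0 \<le> u p) \<and> sum u ?K \<le> 1) *
            ((1 - sum u ?K) ^ of_bool (Suc k \<in> T) * (\<Prod>p\<in>?K. u p ^ ?\<alpha> p))) \<partial>(\<Pi>\<^sub>M p\<in>?K. lborel))"
    unfolding prod_share[OF T] sumK prodK feasible_def by (intro nn_integral_cong) auto
  also have "\<dots> = ennreal (1 / fact (k + card T))"
    by (subst dirichlet_integral) (simp_all only: card factorials, auto)
  finally show ?thesis .
qed

lemma sum_Pow_card: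
  fixes h :: "nat \<Rightarrow> 'a :: comm_semiring_1"
  assumes "finite T"
  shows "(\<Sum>B\<in>Pow T. h (card B)) = (\<Sum>t = 0..card T. of_nat (card T choose t) * h t)"
proof -
  have "(\<Sum>B\<in>Pow T. h (card B)) = (\<Sum>t\<in>{0..card T}. \<Sum>B\<in>{B \<in> Pow T. card B = t}. h (card B))"
    using assms by (intro sum.group[symmetric]) (auto intro: card_mono)
  also have "\<dots> = (\<Sum>t = 0..card T. of_nat (card T choose t) * h t)"
    using assms by (intro sum.cong) (auto simp: n_subsets)
  finally show ?thesis .
qed

text \<open>Supplies the nonnegativity under which \<open>ennreal\<close> commutes with sums and
  products.\<close>

lemma fps_nth_power_nonneg:
  fixes f :: "'a :: linordered_idom fps"
  assumes "\<And>t. 0 \<le> fps_nth f t"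
  shows "0 \<le> fps_nth (f ^ n) t"
proof (induction n arbitrary: t)
  case (Suc n)
  then show ?case
    using assms by (simp add: fps_mult_nth sum_nonneg)
qed (simp add: fps_nth_power_0)

lemma measurable_prod_sum_share:
  assumes "finite J" "T \<subseteq> {1..Suc k}"
  shows "(\<lambda>x. of_bool (\<forall>j\<in>J. feasible k j x) * (\<Prod>i\<in>T. \<Sum>j\<in>J. share k i j x))
         \<in> borel_measurable (\<Pi>\<^sub>M p\<in>{1..k} \<times> J. (lborel :: real measure))"
proof -
  have "i \<in> {1..Suc k}" if "i \<in> T" for i
    using that assms(2) by blast
  then show ?thesis
    using assms(1) by measurable
qed

text \<open>Induction on the columns. Distinct columns occupy disjoint coordinates, so their
  integrals factor; distributing the product over the rows leaves a smaller row set for the old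
  columns, which is why \<open>T\<close> is arbitrary. The resulting convolution is the Cauchy
  product of \<open>g_series (Suc k)\<close> with its power.\<close>

lemma nn_integral_prod_sum_share:
  assumes "finite J" "T \<subseteq> {1..Suc k}"
  shows "(\<integral>\<^sup>+ x. ennreal (of_bool (\<forall>j\<in>J. feasible k j x) * (\<Prod>i\<in>T. \<Sum>j\<in>J. share k i j x))
            \<partial>(\<Pi>\<^sub>M p\<in>{1..k} \<times> J. lborel)) =
         ennreal (fact (card T) * fps_nth (g_series (Suc k) ^ card J) (card T))"
  using assms
proof (induction J arbitrary: T rule: finite_induct)
  case empty
  then have "finite T" using finite_subset by blast
  \<comment> \<open>Without columns every factor is an empty sum, so the integral is 1 for empty
    \<open>T\<close> and 0 otherwise, like the coefficients of the series 1.\<close>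
  then show ?case
    unfolding Sigma_empty2 by (subst lborel_product.nn_integral_empty) auto
next
  case (insert j J)
  let ?K = "{1..k} \<times> {j}" and ?L = "{1..k} \<times> J"
  let ?F = "\<lambda>J T x. of_bool (\<forall>j\<in>J. feasible k j x) * (\<Prod>i\<in>T. \<Sum>j\<in>J. share k i j x)"
  let ?G = "\<lambda>B x. of_bool (feasible k j x) * (\<Prod>i\<in>B. share k i j x)"
  let ?c = "\<lambda>J t. fact t * fps_nth (g_series (Suc k) ^ card J) t :: real"
  have fin: "finite T" using insert.prems finite_subset by blast
  have sub: "i \<in> {1..Suc k}" if "B \<subseteq> T" "i \<in> B" for B i using that insert.prems by blast
  have split: "{1..k} \<times> insert j J = ?K \<union> ?L" by auto
  have F_meas: "?F J B \<in> borel_measurable (\<Pi>\<^sub>M p\<in>{1..k} \<times> J. lborel)" if "finite J" "B \<subseteq> T" for J B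
    using that insert.prems by (intro measurable_prod_sum_share) auto
  have G_meas: "?G B \<in> borel_measurable (\<Pi>\<^sub>M p\<in>?K. lborel)" if "B \<subseteq> T" for B
    using that sub by measurable
  have F_nonneg: "0 \<le> ?F J B x" if "B \<subseteq> T" for J B x
    using sub[OF that] by (auto intro!: prod_nonneg sum_nonneg share_nonneg)
  have G_nonneg: "0 \<le> ?G B x" if "B \<subseteq> T" for B x
    using sub[OF that] by (auto intro!: prod_nonneg share_nonneg)
  have c_nonneg: "0 \<le> ?c J t" for t
    by (intro mult_nonneg_nonneg fps_nth_power_nonneg) (auto simp: g_series_def)
  \<comment> \<open>\<open>B\<close> is the set of rows whose factor is taken from the new column;
    the rows in \<open>T - B\<close> take theirs from the old columns.\<close>
  have merge: "?F (insert j J) T (merge ?K ?L (x, y)) = (\<Sum>B\<in>Pow T. ?G B x * ?F J (T - B) y)" for x y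
  proof -
    have s1: "share k i j (merge ?K ?L (x, y)) = share k i j x" if "i \<in> {1..Suc k}" for i
      using that by (intro share_cong) (auto simp: merge_def)
    have s2: "share k i j' (merge ?K ?L (x, y)) = share k i j' y" if "i \<in> {1..Suc k}" "j' \<in> J" for i j'
      using that insert.hyps by (intro share_cong) (auto simp: merge_def)
    have f1: "feasible k j (merge ?K ?L (x, y)) \<longleftrightarrow> feasible k j x"
      by (intro feasible_cong) (auto simp: merge_def)
    have f2: "feasible k j' (merge ?K ?L (x, y)) \<longleftrightarrow> feasible k j' y" if "j' \<in> J" for j'
      using that insert.hyps by (intro feasible_cong) (auto simp: merge_def)
    have "(\<Prod>i\<in>T. \<Sum>j'\<in>insert j J. share k i j' (merge ?K ?L (x, y))) =
        (\<Prod>i\<in>T. share k i j x + (\<Sum>j'\<in>J. share k i j' y))"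
      using insert.hyps insert.prems s1 s2 by (intro prod.cong) (auto intro!: sum.cong)
    also have "\<dots> = (\<Sum>B\<in>Pow T. (\<Prod>i\<in>B. share k i j x) * (\<Prod>i\<in>T - B. \<Sum>j'\<in>J. share k i j' y))"
      by (rule prod_add[OF fin])
    finally show ?thesis using f1 f2
      by (auto simp: sum_distrib_left)
  qed
  have "(\<integral>\<^sup>+ x. ennreal (?F (insert j J) T x) \<partial>(\<Pi>\<^sub>M p\<in>{1..k} \<times> insert j J. lborel)) =
    (\<integral>\<^sup>+ x. \<integral>\<^sup>+ y. ennreal (?F (insert j J) T (merge ?K ?L (x, y))) \<partial>(\<Pi>\<^sub>M p\<in>?L. lborel) \<partial>(\<Pi>\<^sub>M p\<in>?K. lborel))"
    unfolding split
  proof (rule lborel_product.product_nn_integral_fold)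
    show "(\<lambda>x. ennreal (?F (insert j J) T x)) \<in> borel_measurable (\<Pi>\<^sub>M p\<in>?K \<union> ?L. lborel)"
      using F_meas[of "insert j J" T] insert.hyps unfolding split by simp
  qed (use insert.hyps in auto)
  also have "\<dots> = (\<integral>\<^sup>+ x. \<integral>\<^sup>+ y. (\<Sum>B\<in>Pow T. ennreal (?G B x) * ennreal (?F J (T - B) y))
      \<partial>(\<Pi>\<^sub>M p\<in>?L. lborel) \<partial>(\<Pi>\<^sub>M p\<in>?K. lborel))"
  proof (intro nn_integral_cong)
    fix x y
    have "ennreal (?F (insert j J) T (merge ?K ?L (x, y))) = ennreal (\<Sum>B\<in>Pow T. ?G B x * ?F J (T - B) y)"
      by (simp only: merge)
    also have "\<dots> = (\<Sum>B\<in>Pow T. ennreal (?G B x * ?F J (T - B) y))"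
      by (rule sum_ennreal[symmetric]) (intro mult_nonneg_nonneg F_nonneg G_nonneg; blast)
    also have "\<dots> = (\<Sum>B\<in>Pow T. ennreal (?G B x) * ennreal (?F J (T - B) y))"
      by (intro sum.cong ennreal_mult refl F_nonneg G_nonneg) auto
    finally show "ennreal (?F (insert j J) T (merge ?K ?L (x, y))) = \<dots>" .
  qed
  also have "\<dots> = (\<integral>\<^sup>+ x. (\<Sum>B\<in>Pow T. ennreal (?G B x) * ennreal (?c J (card (T - B)))) \<partial>(\<Pi>\<^sub>M p\<in>?K. lborel))"
  proof (intro nn_integral_cong)
    fix x
    have meas: "(\<lambda>y. ennreal (?F J (T - B) y)) \<in> borel_measurable (\<Pi>\<^sub>M p\<in>?L. lborel)" for B
      using F_meas[OF insert.hyps(1), of "T - B"] by (simp add: Diff_subset)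
    have "(\<integral>\<^sup>+ y. (\<Sum>B\<in>Pow T. ennreal (?G B x) * ennreal (?F J (T - B) y)) \<partial>(\<Pi>\<^sub>M p\<in>?L. lborel)) =
      (\<Sum>B\<in>Pow T. \<integral>\<^sup>+ y. ennreal (?G B x) * ennreal (?F J (T - B) y) \<partial>(\<Pi>\<^sub>M p\<in>?L. lborel))"
      by (rule nn_integral_sum) (intro borel_measurable_times_ennreal borel_measurable_const meas)
    also have "\<dots> = (\<Sum>B\<in>Pow T. ennreal (?G B x) * (\<integral>\<^sup>+ y. ennreal (?F J (T - B) y) \<partial>(\<Pi>\<^sub>M p\<in>?L. lborel)))"
      by (intro sum.cong refl nn_integral_cmult meas)
    also have "\<dots> = (\<Sum>B\<in>Pow T. ennreal (?G B x) * ennreal (?c J (card (T - B))))"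
      using insert.prems by (intro sum.cong refl arg_cong2[where f = "(*)"] insert.IH) auto
    finally show "(\<integral>\<^sup>+ y. (\<Sum>B\<in>Pow T. ennreal (?G B x) * ennreal (?F J (T - B) y)) \<partial>(\<Pi>\<^sub>M p\<in>?L. lborel)) = \<dots>" .
  qed
  also have "\<dots> = (\<Sum>B\<in>Pow T. ennreal (1 / fact (k + card B)) * ennreal (?c J (card (T - B))))"
  proof -
    have meas: "(\<lambda>y. ennreal (?G B y)) \<in> borel_measurable (\<Pi>\<^sub>M p\<in>?K. lborel)" if "B \<in> Pow T" for B
      using G_meas[of B] that by simp
    have "(\<integral>\<^sup>+ x. (\<Sum>B\<in>Pow T. ennreal (?G B x) * ennreal (?c J (card (T - B)))) \<partial>(\<Pi>\<^sub>M p\<in>?K. lborel)) =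
      (\<Sum>B\<in>Pow T. \<integral>\<^sup>+ x. ennreal (?G B x) * ennreal (?c J (card (T - B))) \<partial>(\<Pi>\<^sub>M p\<in>?K. lborel))"
      by (rule nn_integral_sum) (intro borel_measurable_times_ennreal borel_measurable_const meas)
    also have "\<dots> = (\<Sum>B\<in>Pow T. (\<integral>\<^sup>+ x. ennreal (?G B x) \<partial>(\<Pi>\<^sub>M p\<in>?K. lborel)) * ennreal (?c J (card (T - B))))"
      by (intro sum.cong refl nn_integral_multc meas)
    also have "\<dots> = (\<Sum>B\<in>Pow T. ennreal (1 / fact (k + card B)) * ennreal (?c J (card (T - B))))"
      using insert.prems by (intro sum.cong refl arg_cong2[where f = "(*)"] nn_integral_prod_share) auto
    finally show ?thesis .
  qed
  also have "\<dots> = (\<Sum>B\<in>Pow T. ennreal (1 / fact (k + card B) * ?c J (card (T - B))))"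
    by (intro sum.cong refl ennreal_mult[symmetric] c_nonneg) auto
  also have "\<dots> = ennreal (\<Sum>B\<in>Pow T. 1 / fact (k + card B) * ?c J (card (T - B)))"
    by (intro sum_ennreal mult_nonneg_nonneg c_nonneg) auto
  also have "(\<Sum>B\<in>Pow T. 1 / fact (k + card B) * ?c J (card (T - B))) = 
      (\<Sum>B\<in>Pow T. 1 / fact (k + card B) * ?c J (card T - card B))"
    using fin by (intro sum.cong) (auto simp: card_Diff_subset finite_subset)
  also have "\<dots> = (\<Sum>t = 0..card T. of_nat (card T choose t) * (1 / fact (k + t) * ?c J (card T - t)))"
    by (rule sum_Pow_card[OF fin])
  \<comment> \<open>The binomial coefficient times \<open>fact (card T - t)\<close> is
    \<open>fact (card T) / fact t\<close>; the factor \<open>1 / fact t\<close> completes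
    \<open>1 / fact (k + t)\<close> to a coefficient of \<open>g_series (Suc k)\<close>.\<close>
  also have "\<dots> = (\<Sum>t = 0..card T. fact (card T) *
      (fps_nth (g_series (Suc k)) t * fps_nth (g_series (Suc k) ^ card J) (card T - t)))"
    by (intro sum.cong) (auto simp: g_series_def binomial_fact)
  also have "\<dots> = ?c (insert j J) (card T)"
    using insert.hyps by (simp add: fps_mult_nth sum_distrib_left)
  finally show ?case .
qed

subsection \<open>Coefficients of powers of a power series\<close>

lemma fps_nth_power_eq_0:
  fixes a :: "'a :: comm_ring_1 fps"
  assumes "fps_nth a 0 = 0" "t < k"
  shows "fps_nth (a ^ k) t = 0"
  using startsby_zero_power_prefix[OF assms(1)] assms(2) by blast

lemma fps_nth_power_self:
  fixes a :: "'a :: comm_ring_1 fps"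
  assumes "fps_nth a 0 = 0"
  shows "fps_nth (a ^ t) t = fps_nth a 1 ^ t"
  using assms fps_power_zeroth_eq_one startsby_zero_power_nth_same by fastforce

text \<open>Since \<open>a ^ k\<close> has no terms below degree \<open>k\<close>, the binomial
  expansion stops at \<open>t\<close>. The range of summation is then independent of
  \<open>n\<close>, and each summand is a polynomial in \<open>n\<close>.\<close>

lemma fps_nth_one_plus_power:
  fixes a :: "'a :: field_char_0 fps"
  assumes "fps_nth a 0 = 0"
  shows "fps_nth ((1 + a) ^ n) t =
    (\<Sum>k\<le>t. (\<Prod>i<k. of_nat n - of_nat i) / fact k * fps_nth (a ^ k) t)"
proof -
  have c: "of_nat (n choose k) = (\<Prod>i<k. of_nat n - of_nat i) / (fact k :: 'a)" for k
    by (simp add: binomial_gbinomial gbinomial_prod_rev atLeast0LessThan)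
  have "(1 + a) ^ n = (\<Sum>k\<le>n. of_nat (n choose k) * a ^ k)"
    by (subst add.commute, subst binomial_ring) simp
  then have "fps_nth ((1 + a) ^ n) t = (\<Sum>k\<le>n. of_nat (n choose k) * fps_nth (a ^ k) t)"
    by (simp add: fps_sum_nth flip: fps_of_nat)
  \<comment> \<open>The range is first enlarged, as the binomial coefficient vanishes for
    \<open>k > n\<close>, and then cut down to \<open>k \<le> t\<close>.\<close>
  also have "\<dots> = (\<Sum>k\<le>max n t. of_nat (n choose k) * fps_nth (a ^ k) t)"
    by (rule sum.mono_neutral_left) auto
  also have "\<dots> = (\<Sum>k\<le>t. of_nat (n choose k) * fps_nth (a ^ k) t)"
    by (rule sum.mono_neutral_right) (auto simp: fps_nth_power_eq_0 assms)
  finally show ?thesis by (simp only: c)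
qed

text \<open>Dividing the falling factorial of length \<open>k\<close> by \<open>n ^ t\<close> gives
  \<open>(1 / n) ^ (t - k)\<close> times the product of the \<open>1 - i / n\<close> for
  \<open>i < k\<close>, a polynomial in \<open>1 / n\<close> of degree at most
  \<open>t\<close>.\<close>

lemma fps_nth_power_polynomial:
  fixes f :: "real fps"
  assumes "fps_nth f 0 = 1"
  obtains p where "degree p \<le> t" "coeff p 0 = fps_nth f 1 ^ t / fact t"
    "\<And>n. n \<ge> 1 \<Longrightarrow> fps_nth (f ^ n) t / real n ^ t = poly p (1 / real n)"
proof
  define a where "a = f - 1"
  have f: "f = 1 + a" and a0: "fps_nth a 0 = 0" and a1: "fps_nth a 1 = fps_nth f 1"
    using assms by (auto simp: a_def)
  \<comment> \<open>The summand of index \<open>k\<close> after division by \<open>n ^ t\<close>,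
    with \<open>1 / n\<close> replaced by the indeterminate.\<close>
  define q where "q k = smult (fps_nth (a ^ k) t / fact k) (monom 1 (t - k) * (\<Prod>i<k. [:1, - real i:]))" for k
  define p where "p = (\<Sum>k\<le>t. q k)"
  have "degree (\<Prod>i<k. [:1, - real i:]) \<le> k" for k
    using degree_prod_sum_le[of "{..<k}" "\<lambda>i. [:1, - real i:]"]
      sum_mono[of "{..<k}" "\<lambda>i. degree [:1, - real i:]" "\<lambda>_. 1"] by (auto intro: order_trans)
  then have "degree (q k) \<le> t" if "k \<le> t" for k
    unfolding q_def using that
    by (intro order_trans[OF degree_smult_le] order_trans[OF degree_mult_le])
       (metis add_mono degree_monom_le le_add_diff_inverse2)
  then show "degree p \<le> t"
    unfolding p_def by (intro degree_sum_le) auto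
  have "coeff p 0 = (\<Sum>k\<le>t. poly (q k) 0)"
    by (simp add: p_def poly_sum flip: poly_0_coeff_0)
  \<comment> \<open>At 0 the monomial kills every summand but \<open>k = t\<close>, where the lowest
    coefficient of \<open>a ^ t\<close> remains.\<close>
  also have "\<dots> = (\<Sum>k\<le>t. if k = t then fps_nth f 1 ^ t / fact t else 0)"
    by (intro sum.cong)
       (auto simp: q_def poly_prod poly_monom fps_nth_power_self a0 a1 zero_power simp del: One_nat_def)
  finally show "coeff p 0 = fps_nth f 1 ^ t / fact t" by simp
  fix n :: nat assume n: "n \<ge> 1"
  have "poly (q k) (1 / real n) * real n ^ t = (\<Prod>i<k. real n - real i) / fact k * fps_nth (a ^ k) t"
    if "k \<le> t" for k
  proof -
    have "(1 / real n) ^ (t - k) * (\<Prod>i<k. 1 - real i / real n) * real n ^ t =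
        (\<Prod>i<k. real n * (1 - real i / real n))"
      using n that by (simp add: prod.distrib power_diff power_one_over)
    also have "\<dots> = (\<Prod>i<k. real n - real i)"
      using n by (intro prod.cong) (auto simp: field_simps)
    finally show ?thesis
      by (simp add: q_def poly_prod poly_monom mult_ac)
  qed
  then have "poly p (1 / real n) * real n ^ t = fps_nth (f ^ n) t"
    by (simp add: p_def poly_sum sum_distrib_right f fps_nth_one_plus_power[OF a0])
  then show "fps_nth (f ^ n) t / real n ^ t = poly p (1 / real n)"
    using n by (simp add: field_simps)
qed

section \<open>The closed formula: polynomiality in 1/n and the cases m = 2 and m = 3\<close>

definition volume_formula :: "nat \<Rightarrow> nat \<Rightarrow> real" where
  "volume_formula m n =
     (\<Sum>t = 0..m. real (m choose t) * (- (1 / real n)) ^ t * fact t * fps_nth (g_series m ^ n) t)"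

text \<open>Scaled to constant coefficient 1, as the expansion of \<open>(1 + a) ^ n\<close>
  requires. This is the source of the factor \<open>fact (m - 1) ^ n\<close>.\<close>

definition normalized_series :: "nat \<Rightarrow> real fps" where
  "normalized_series m = fps_const (fact (m - 1)) * g_series m"

lemma g_series_power: "fps_nth (g_series m ^ n) t = fps_nth (normalized_series m ^ n) t / fact (m - 1) ^ n"
  by (simp add: normalized_series_def power_mult_distrib fps_const_power)

lemma normalized_series_nth:
  "fps_nth (normalized_series m) t = fact (m - 1) / (fact t * fact (m - 1 + t))"
  by (simp add: normalized_series_def g_series_def)

lemma volume_formula_normalized:
  "fact (m - 1) ^ n * volume_formula m n =
     (\<Sum>t = 0..m. real (m choose t) * (- 1) ^ t * fact t * (fps_nth (normalized_series m ^ n) t / real n ^ t))"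
  unfolding volume_formula_def sum_distrib_left
  by (intro sum.cong) (auto simp: g_series_power power_minus[of "1 / real n"] power_divide)

text \<open>The linear coefficient of the normalized series is \<open>1 / m\<close>. In the constant
  terms \<open>fact t\<close> cancels, and the binomial theorem sums what is left.\<close>

lemma volume_formula_polynomial:
  assumes "m \<ge> 1"
  obtains p :: "real poly" where "degree p \<le> m" "coeff p 0 = (1 - 1 / real m) ^ m"
    "\<And>n. n \<ge> 1 \<Longrightarrow> fact (m - 1) ^ n * volume_formula m n = poly p (1 / real n)"
proof -
  have h0: "fps_nth (normalized_series m) 0 = 1" by (simp add: normalized_series_nth)
  have h1: "fps_nth (normalized_series m) 1 = 1 / real m"
    using assms by (cases m) (simp_all add: normalized_series_nth del: of_nat_Suc)
  have "\<exists>p. degree p \<le> t \<and> coeff p 0 = (1 / real m) ^ t / fact t \<and>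
      (\<forall>n\<ge>1. fps_nth (normalized_series m ^ n) t / real n ^ t = poly p (1 / real n))" for t
    using fps_nth_power_polynomial[OF h0, of t] unfolding h1 by metis
  then obtain P where P: "degree (P t) \<le> t" "coeff (P t) 0 = (1 / real m) ^ t / fact t"
      "n \<ge> 1 \<Longrightarrow> fps_nth (normalized_series m ^ n) t / real n ^ t = poly (P t) (1 / real n)" for t n
    by metis
  define p where "p = (\<Sum>t = 0..m. smult (real (m choose t) * (- 1) ^ t * fact t) (P t))"
  show ?thesis
  proof
    show "degree p \<le> m"
      unfolding p_def
      by (intro degree_sum_le order_trans[OF degree_smult_le] order_trans[OF P(1)]) auto
    have "coeff p 0 = (\<Sum>t = 0..m. real (m choose t) * (- 1) ^ t * (1 / real m) ^ t)"
      by (simp add: p_def coeff_sum P(2) mult.assoc)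
    also have "\<dots> = (\<Sum>t\<le>m. real (m choose t) * (- 1 / real m) ^ t * 1 ^ (m - t))"
      by (intro sum.cong) (auto simp: mult.assoc power_minus[of "1 / real m"])
    also have "\<dots> = (1 - 1 / real m) ^ m"
      by (subst binomial_ring[symmetric]) simp
    finally show "coeff p 0 = (1 - 1 / real m) ^ m" .
    show "fact (m - 1) ^ n * volume_formula m n = poly p (1 / real n)" if "n \<ge> 1" for n
      unfolding volume_formula_normalized P(3)[OF that] by (simp add: p_def poly_sum)
  qed
qed

text \<open>For a numeral \<open>m\<close> all ranges of summation are explicit while
  \<open>n\<close> stays symbolic, so the small cases reduce to arithmetic.\<close>

lemma volume_formula_expand:
  "fact (m - 1) ^ n * volume_formula m n =
     (\<Sum>t\<le>m. real (m choose t) * (- 1) ^ t * fact t *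
       ((\<Sum>k\<le>t. (\<Prod>i<k. real n - real i) / fact k * fps_nth ((normalized_series m - 1) ^ k) t) / real n ^ t))"
  using fps_nth_one_plus_power[of "normalized_series m - 1" n]
  unfolding volume_formula_normalized by (simp add: normalized_series_nth atLeast0AtMost)

lemma volume_formula_2:
  assumes "n \<ge> 1"
  shows "volume_formula 2 n = (3 * real n - 1) / (12 * real n)"
  using assms volume_formula_expand[of 2 n]
  by (simp add: numeral_2_eq_2 fps_mult_nth normalized_series_nth)
     (simp add: field_simps power2_eq_square eval_nat_numeral)

lemma volume_formula_3:
  assumes "n \<ge> 1"
  shows "volume_formula 3 n = (80 * real n ^ 2 - 15 * real n - 2) / (270 * 2 ^ n * real n ^ 2)"
proof -
  \<comment> \<open>The claim with its denominators cleared and a common nonzero factor, which is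
    cancelled below; \<open>2 ^ n\<close> is the normalizing factor
    \<open>fact (3 - 1) ^ n\<close>.\<close>
  have "real n ^ 3 * 72 * (2 + 15 * real n + 270 * (2 ^ n * volume_formula 3 n) * real n ^ 2) =
      real n ^ 3 * 72 * (80 * real n ^ 2)"
    using assms volume_formula_expand[of 3 n]
    by (simp add: numeral_2_eq_2 numeral_3_eq_3 fps_mult_nth normalized_series_nth)
       (simp add: field_simps power2_eq_square)
  moreover have "real n ^ 3 * 72 \<noteq> 0"
    using assms by simp
  ultimately have "2 + 15 * real n + 270 * (2 ^ n * volume_formula 3 n) * real n ^ 2 = 80 * real n ^ 2"
    by (metis mult_left_cancel)
  then show ?thesis
    using assms by (simp add: field_simps)
qed

subsection \<open>The volume\<close>

lemma sum_share: "(\<Sum>i\<in>{1..Suc k}. share k i j x) = 1"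
proof -
  have "(\<Sum>i\<in>{1..k}. share k i j x) = (\<Sum>i\<in>{1..k}. x (i, j))"
    by (intro sum.cong) (auto simp: share_def)
  then show ?thesis
    by (simp add: share_def)
qed

text \<open>One of several nonnegative numbers with sum 1. This recovers the upper bounds on the
  entries and later makes the intervals for \<open>y i\<close> nonempty.\<close>

lemma share_le_1:
  assumes "feasible k j x" "i \<in> {1..Suc k}"
  shows "share k i j x \<le> 1"
  using member_le_sum[of i "{1..Suc k}" "\<lambda>i. share k i j x"] assms share_nonneg[OF assms(1)]
  unfolding sum_share by auto

text \<open>The constraints after elimination of the last row, arranged so that the slice over each
  feasible \<open>x\<close> is a box in \<open>y\<close>.\<close>

definition volume_region :: "nat \<Rightarrow> nat \<Rightarrow> point set" where
  "volume_region k n =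
     {(x, y) \<in> (({1..k} \<times> {1..n}) \<rightarrow>\<^sub>E UNIV) \<times> ({1..Suc k} \<rightarrow>\<^sub>E UNIV).
        (\<forall>j\<in>{1..n}. feasible k j x) \<and>
        (\<forall>i\<in>{1..Suc k}. (\<Sum>j\<in>{1..n}. share k i j x) / real n \<le> y i \<and> y i \<le> 1)}"

lemma demand_proj_image:
  assumes n: "n \<ge> 1"
  shows "demand_proj (Suc k) n ` (weak_relaxation (Suc k) n \<inter> demand_space (Suc k) n) = volume_region k n"
proof (intro equalityI subsetI)
  fix z assume "z \<in> demand_proj (Suc k) n ` (weak_relaxation (Suc k) n \<inter> demand_space (Suc k) n)"
  then obtain x y where z: "z = (restrict x ({1..k} \<times> {1..n}), y)"
    and y: "y \<in> {1..Suc k} \<rightarrow>\<^sub>E UNIV" "\<forall>i\<in>{1..Suc k}. y i \<le> 1"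
    and S: "\<forall>i\<in>{1..Suc k}. (\<Sum>j\<in>{1..n}. x (i, j)) \<le> real n * y i"
    and x: "\<forall>i\<in>{1..Suc k}. \<forall>j\<in>{1..n}. 0 \<le> x (i, j) \<and> x (i, j) \<le> 1"
    and one: "\<forall>j\<in>{1..n}. (\<Sum>i\<in>{1..Suc k}. x (i, j)) = 1"
    by (auto simp: weak_relaxation_def demand_space_def demand_proj_def ambient_def
             simp del: sum.cl_ivl_Suc atLeastAtMost_iff)
  let ?x = "restrict x ({1..k} \<times> {1..n})"
  have col: "(\<Sum>i\<in>{1..k}. ?x (i, j)) = 1 - x (Suc k, j)" if "j \<in> {1..n}" for j
  proof -
    have "(\<Sum>i\<in>{1..k}. ?x (i, j)) = (\<Sum>i\<in>{1..k}. x (i, j))"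
      using that by (intro sum.cong) auto
    then show ?thesis using one[rule_format, OF that] by simp
  qed
  \<comment> \<open>For \<open>i = Suc k\<close> this is the demand equation of column
    \<open>j\<close>.\<close>
  have share: "share k i j ?x = x (i, j)" if "i \<in> {1..Suc k}" "j \<in> {1..n}" for i j
    using that col[OF that(2)] by (auto simp: share_def)
  have "feasible k j ?x" if j: "j \<in> {1..n}" for j
  proof -
    have "0 \<le> x (Suc k, j)" using x j by simp
    then show ?thesis
      unfolding feasible_def col[OF j] using x j by auto
  qed
  moreover have "(\<Sum>j\<in>{1..n}. share k i j ?x) / real n \<le> y i" if i: "i \<in> {1..Suc k}" for i
  proof -
    have "(\<Sum>j\<in>{1..n}. share k i j ?x) = (\<Sum>j\<in>{1..n}. x (i, j))"
      using share[OF i] by (intro sum.cong) auto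
    also have "\<dots> \<le> real n * y i" using S i by blast
    finally show ?thesis using n by (simp add: field_simps)
  qed
  ultimately show "z \<in> volume_region k n"
    using y by (auto simp: volume_region_def z)
next
  fix z assume "z \<in> volume_region k n"
  then obtain x y where z: "z = (x, y)"
    and x: "x \<in> ({1..k} \<times> {1..n}) \<rightarrow>\<^sub>E UNIV" and y: "y \<in> {1..Suc k} \<rightarrow>\<^sub>E UNIV" "\<forall>i\<in>{1..Suc k}. y i \<le> 1"
    and f: "\<forall>j\<in>{1..n}. feasible k j x"
    and S: "\<forall>i\<in>{1..Suc k}. (\<Sum>j\<in>{1..n}. share k i j x) / real n \<le> y i"
    by (auto simp: volume_region_def simp del: atLeastAtMost_iff)
  \<comment> \<open>The preimage: its last row is what the demand equations dictate.\<close>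
  let ?x = "restrict (\<lambda>(i, j). share k i j x) ({1..Suc k} \<times> {1..n})"
  have col: "(\<Sum>i\<in>{1..Suc k}. ?x (i, j)) = 1" if "j \<in> {1..n}" for j
  proof -
    have "(\<Sum>i\<in>{1..Suc k}. ?x (i, j)) = (\<Sum>i\<in>{1..Suc k}. share k i j x)"
      using that by (intro sum.cong) auto
    then show ?thesis by (simp only: sum_share)
  qed
  have row: "(\<Sum>j\<in>{1..n}. ?x (i, j)) \<le> real n * y i" if i: "i \<in> {1..Suc k}" for i
  proof -
    have "(\<Sum>j\<in>{1..n}. ?x (i, j)) = (\<Sum>j\<in>{1..n}. share k i j x)"
      using i by (intro sum.cong) auto
    also have "\<dots> \<le> real n * y i"
      using S[rule_format, OF i] n by (simp add: field_simps)
    finally show ?thesis .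
  qed
  have bounds: "0 \<le> ?x (i, j) \<and> ?x (i, j) \<le> 1" if "i \<in> {1..Suc k}" "j \<in> {1..n}" for i j
    using that share_nonneg[of k j x i] share_le_1[of k j x i] f by simp
  have "restrict ?x ({1..k} \<times> {1..n}) = x"
  proof
    fix p show "restrict ?x ({1..k} \<times> {1..n}) p = x p"
      using x by (cases p) (auto simp: share_def PiE_def extensional_def)
  qed
  then have "z = demand_proj (Suc k) n (?x, y)"
    by (simp add: demand_proj_def z)
  moreover have "(?x, y) \<in> ambient (Suc k) n"
    using y(1) by (simp add: ambient_def)
  ultimately show "z \<in> demand_proj (Suc k) n ` (weak_relaxation (Suc k) n \<inter> demand_space (Suc k) n)"
    using col row bounds y(2) unfolding weak_relaxation_def demand_space_def by blast
qed

text \<open>Tonelli's theorem reduces the volume to the integral of the box volumes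
  \<open>?D\<close>. Expanding their product over subsets of the rows leaves the integrals already
  computed, which depend only on the size of the subset.\<close>

lemma Vol_eq_volume_formula:
  assumes n: "n \<ge> 1"
  shows "Vol (Suc k) n (weak_relaxation (Suc k) n \<inter> demand_space (Suc k) n) = volume_formula (Suc k) n"
proof -
  let ?J = "{1..n}" and ?M = "{1..Suc k}"
  let ?P = "\<Pi>\<^sub>M p\<in>{1..k} \<times> ?J. lborel :: real measure"
  let ?Q = "\<Pi>\<^sub>M i\<in>?M. lborel :: real measure"
  let ?S = "\<lambda>i x. \<Sum>j\<in>?J. share k i j x"
  let ?F = "\<lambda>T x. of_bool (\<forall>j\<in>?J. feasible k j x) * (\<Prod>i\<in>T. ?S i x)"
  let ?D = "\<lambda>x. of_bool (\<forall>j\<in>?J. feasible k j x) * (\<Prod>i\<in>?M. 1 - ?S i x / real n)"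
  let ?c = "\<lambda>t. fact t * fps_nth (g_series (Suc k) ^ n) t :: real"
  have load: "0 \<le> ?S i x" "?S i x / real n \<le> 1" if "\<forall>j\<in>?J. feasible k j x" "i \<in> ?M" for i x
  proof -
    show "0 \<le> ?S i x" using that by (intro sum_nonneg share_nonneg) auto
    have "?S i x \<le> (\<Sum>j\<in>?J. 1)" using that by (intro sum_mono share_le_1) auto
    then show "?S i x / real n \<le> 1" using n by simp
  qed
  have D_nonneg: "0 \<le> ?D x" for x
  proof (cases "\<forall>j\<in>?J. feasible k j x")
    case True
    then show ?thesis
      using load(2)[OF True] by (intro mult_nonneg_nonneg prod_nonneg) auto
  qed auto
  have sets: "volume_region k n \<in> sets (?P \<Otimes>\<^sub>M ?Q)"
  proof -
    have [measurable]: "Measurable.pred (?P \<Otimes>\<^sub>M ?Q) (\<lambda>z. feasible k j (fst z))" if "j \<in> ?J" for j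
      by (rule measurable_compose[OF measurable_fst measurable_feasible[OF that]])
    have [measurable]: "(\<lambda>z. share k i j (fst z)) \<in> borel_measurable (?P \<Otimes>\<^sub>M ?Q)"
      if "i \<in> ?M" "j \<in> ?J" for i j
      by (rule measurable_compose[OF measurable_fst measurable_share[OF that]])
    have [measurable]: "(\<lambda>z. snd z i) \<in> borel_measurable (?P \<Otimes>\<^sub>M ?Q)" if "i \<in> ?M" for i
      using that by measurable
    have "volume_region k n = {z \<in> space (?P \<Otimes>\<^sub>M ?Q). (\<forall>j\<in>?J. feasible k j (fst z)) \<and>
        (\<forall>i\<in>?M. ?S i (fst z) / real n \<le> snd z i \<and> snd z i \<le> 1)}"
      by (auto simp: volume_region_def space_pair_measure space_PiM)
    also have "\<dots> \<in> sets (?P \<Otimes>\<^sub>M ?Q)"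
      by measurable
    finally show ?thesis .
  qed
  have slice: "emeasure ?Q (Pair x -` volume_region k n) = ennreal (?D x)" if x: "x \<in> space ?P" for x
  proof (cases "\<forall>j\<in>?J. feasible k j x")
    case True
    have "Pair x -` volume_region k n = (\<Pi>\<^sub>E i\<in>?M. {?S i x / real n..1})"
      using x True unfolding volume_region_def space_PiM PiE_def Pi_def by auto
    then have "emeasure ?Q (Pair x -` volume_region k n) = (\<Prod>i\<in>?M. emeasure lborel {?S i x / real n..1})"
      by (simp only:) (rule lborel_product.emeasure_PiM; simp)
    also have "\<dots> = (\<Prod>i\<in>?M. ennreal (1 - ?S i x / real n))"
      using load(2)[OF True] by (intro prod.cong) auto
    also have "\<dots> = ennreal (\<Prod>i\<in>?M. 1 - ?S i x / real n)"
      using load(2)[OF True] by (intro prod_ennreal) auto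
    finally show ?thesis using True by simp
  next
    case False
    then have "Pair x -` volume_region k n = {}"
      by (auto simp: volume_region_def)
    then show ?thesis using False by auto
  qed
  interpret Q: sigma_finite_measure ?Q
    by (rule lborel_product.sigma_finite) simp
  have "emeasure (?P \<Otimes>\<^sub>M ?Q) (volume_region k n) = (\<integral>\<^sup>+ x. ennreal (?D x) \<partial>?P)"
    unfolding Q.emeasure_pair_measure_alt[OF sets] by (intro nn_integral_cong slice)
  \<comment> \<open>The expansion has alternating signs, so the nonnegative integrals of the
    \<open>?F T\<close> are first turned into Bochner integrals.\<close>
  moreover have int: "has_bochner_integral ?P ?D (volume_formula (Suc k) n)"
  proof -
    have "has_bochner_integral ?P (?F T) (?c (card T))" if T: "T \<subseteq> ?M" for T
    proof (rule has_bochner_integral_nn_integral)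
      show "?F T \<in> borel_measurable ?P"
        using T by (intro measurable_prod_sum_share) auto
      show "AE x in ?P. 0 \<le> ?F T x"
        using load(1) T by (intro AE_I2) (auto intro!: prod_nonneg)
      show "0 \<le> ?c (card T)"
        by (intro mult_nonneg_nonneg fps_nth_power_nonneg) (auto simp: g_series_def)
      show "(\<integral>\<^sup>+ x. ennreal (?F T x) \<partial>?P) = ennreal (?c (card T))"
        using nn_integral_prod_sum_share[of ?J T k] T by simp
    qed
    then have "has_bochner_integral ?P (\<lambda>x. \<Sum>T\<in>Pow ?M. (- (1 / real n)) ^ card T * ?F T x)
        (\<Sum>T\<in>Pow ?M. (- (1 / real n)) ^ card T * ?c (card T))"
      by (intro has_bochner_integral_sum has_bochner_integral_mult_right) auto
    also have "(\<Sum>T\<in>Pow ?M. (- (1 / real n)) ^ card T * ?c (card T)) = volume_formula (Suc k) n"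
      by (subst sum_Pow_card) (auto simp: volume_formula_def mult_ac intro!: sum.cong)
    also have "(\<lambda>x. \<Sum>T\<in>Pow ?M. (- (1 / real n)) ^ card T * ?F T x) = ?D"
    proof
      fix x
      have "(\<Prod>i\<in>?M. 1 - ?S i x / real n) = (\<Prod>i\<in>?M. - (1 / real n) * ?S i x + 1)"
        by (intro prod.cong) auto
      also have "\<dots> = (\<Sum>T\<in>Pow ?M. (- (1 / real n)) ^ card T * (\<Prod>i\<in>T. ?S i x))"
        by (subst prod_add) (simp_all only: prod.distrib prod_constant power_one mult_1_right finite_atLeastAtMost)
      finally show "(\<Sum>T\<in>Pow ?M. (- (1 / real n)) ^ card T * ?F T x) = ?D x"
        by (auto simp: sum_distrib_left)
    qed
    finally show ?thesis .
  qed
  ultimately have "emeasure (?P \<Otimes>\<^sub>M ?Q) (volume_region k n) = ennreal (volume_formula (Suc k) n)"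
    using D_nonneg by (simp add: nn_integral_eq_integral has_bochner_integral_iff)
  moreover have "0 \<le> volume_formula (Suc k) n"
    unfolding has_bochner_integral_integral_eq[OF int, symmetric]
    by (rule Bochner_Integration.integral_nonneg) (rule D_nonneg)
  \<comment> \<open>The region is measurable in the product itself, so passing to the completion
    does not change its measure; nonnegativity of the value lets it be read back from
    \<open>ennreal\<close>.\<close>
  ultimately show ?thesis
    using sets
    by (simp add: Vol_def demand_proj_image[OF n] proj_lebesgue_def measure_def)
qed

theorem theorem2:
  "(\<forall>m\<ge>2. \<forall>n\<ge>1.
      Vol m n (weak_relaxation m n \<inter> demand_space m n) =
        (\<Sum>t = 0..m. real (m choose t) * (- (1 / real n)) ^ t * fact t * fps_nth (g_series m ^ n) t)) \<and>
   (\<forall>n\<ge>1. Vol 2 n (weak_relaxation 2 n \<inter> demand_space 2 n) =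
      (3 * real n - 1) / (12 * real n)) \<and>
   (\<forall>n\<ge>1. Vol 3 n (weak_relaxation 3 n \<inter> demand_space 3 n) =
      (80 * real n ^ 2 - 15 * real n - 2) / (270 * 2 ^ n * real n ^ 2)) \<and>
   (\<forall>m\<ge>2. \<exists>p :: real poly. degree p \<le> m \<and> coeff p 0 = (1 - 1 / real m) ^ m \<and>
      (\<forall>n\<ge>1. fact (m - 1) ^ n * Vol m n (weak_relaxation m n \<inter> demand_space m n) =
         poly p (1 / real n)))"
proof -
  have Vol: "Vol m n (weak_relaxation m n \<inter> demand_space m n) = volume_formula m n"
    if "m \<ge> 2" "n \<ge> 1" for m n
    using Vol_eq_volume_formula[of n "m - 1"] that by simp
  have "\<exists>p. degree p \<le> m \<and> coeff p 0 = (1 - 1 / real m) ^ m \<and>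
      (\<forall>n\<ge>1. fact (m - 1) ^ n * volume_formula m n = poly p (1 / real n))" if "m \<ge> 2" for m
    using volume_formula_polynomial[of m] that by (metis One_nat_def Suc_1 Suc_leD)
  then show ?thesis
    by (simp add: Vol volume_formula_2 volume_formula_3 flip: volume_formula_def)
qed

end
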